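(* Let $0<\mu\le L$ and let $f:\mathbb{R}^d\to\mathbb{R}$ be continuously differentiable, $L$-smooth and $\mu$-strongly convex, with minimizer $x^*$ and $f^*=f(x^* )$. Let $0\le\tau\le\frac12$, $$\alpha=\frac13\left(\frac{\mu}{L}\right)^{\frac12-\tau},$$ and let $\widetilde\nabla f:\mathbb{R}^d\to\mathbb{R}^d$ satisfy $\|\widetilde\nabla f(x)-\nabla f(x)\|_2\le\alpha\|\nabla f(x)\|_2$ for all $x\in\mathbb{R}^d$. Let $x^0\in\mathbb{R}^d$, $R=\|x^0-x^*\|_2$. Then for every $N\ge0$ the point $x^N$ generated by RE-AGM with parameters $(L,\frac{\mu}{2},x^0,\alpha)$ satisfies $$f(x^N)-f^*\le L R^2\left(1-\frac{1}{10\sqrt2}\left(\frac{\mu}{L}\right)^{\frac12+\tau}\right)^N .$$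
   Context: $f$ is $L$-smooth and $\mu$-strongly convex if for all $x,y\in\mathbb{R}^d$: $\frac{\mu}{2}\|y-x\|_2^2\le f(y)-f(x)-\langle\nabla f(x),y-x\rangle\le\frac{L}{2}\|y-x\|_2^2$. RE-AGM (Relative Error Accelerated Gradient Method) with parameters $(L,\bar\mu,x_{\rm start},\alpha)$ (in the claim $\bar\mu=\mu/2$, $x_{\rm start}=x^0$): set $h=\frac1L\left(\frac{1-\alpha}{1+\alpha}\right)^{3/2}$, $\widehat L=\frac{L(1+\alpha)}{(1-\alpha)^3}$, $x^0=u^0=x_{\rm start}$, $s=1+2\alpha+2\alpha^2$, $m=1-2\alpha$, $q=\bar\mu/\widehat L$. For $k=0,1,2,\dots$ let $a_k=\frac{(m-s)+\sqrt{(s-m)^2+4mq}}{2m}$ (the largest root of $m a^2+(s-m)a-q=0$; it does not depend on $k$), and $$y^k=\frac{a_ku^k+x^k}{1+a_k},\quad u^{k+1}=(1-a_k)u^k+a_ky^k-\frac{a_k}{\bar\mu}\widetilde\nabla f(y^k),\quad x^{k+1}=y^k-h\widetilde\nabla f(y^k).$$ *)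

theory Defs
  imports "HOL-Analysis.Analysis"
begin

text \<open>
  In the following, \<open>gf\<close> stands for the gradient of \<open>f\<close>; that it really is the gradient
  is a separate hypothesis, expressed by \<open>GDERIV\<close>.
\<close>

definition smooth_strongly_convex ::
  "real \<Rightarrow> real \<Rightarrow> ('a::real_inner \<Rightarrow> real) \<Rightarrow> ('a \<Rightarrow> 'a) \<Rightarrow> bool" where
  "smooth_strongly_convex L \<mu> f gf \<longleftrightarrow>
     (\<forall>x y. \<mu> / 2 * (norm (y - x))\<^sup>2 \<le> f y - f x - inner (gf x) (y - x) \<and>
            f y - f x - inner (gf x) (y - x) \<le> L / 2 * (norm (y - x))\<^sup>2)"

definition relative_error_gradient ::
  "real \<Rightarrow> ('a::real_normed_vector \<Rightarrow> 'a) \<Rightarrow> ('a \<Rightarrow> 'a) \<Rightarrow> bool" where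
  "relative_error_gradient \<alpha> gf g \<longleftrightarrow> (\<forall>x. norm (g x - gf x) \<le> \<alpha> * norm (gf x))"

definition reagm_h :: "real \<Rightarrow> real \<Rightarrow> real" where
  "reagm_h L \<alpha> = 1 / L * ((1 - \<alpha>) / (1 + \<alpha>)) powr (3 / 2)"

definition reagm_Lhat :: "real \<Rightarrow> real \<Rightarrow> real" where
  "reagm_Lhat L \<alpha> = L * (1 + \<alpha>) / (1 - \<alpha>) ^ 3"

text \<open>
  For \<open>\<alpha> < 1/2\<close> and \<open>q \<ge> 0\<close> this is the largest root \<open>a\<close> of \<open>m * a\<^sup>2 + (s - m) * a - q = 0\<close>.
\<close>

definition reagm_a :: "real \<Rightarrow> real \<Rightarrow> real \<Rightarrow> real" where
  "reagm_a L mubar \<alpha> =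
     (let s = 1 + 2 * \<alpha> + 2 * \<alpha>\<^sup>2;
          m = 1 - 2 * \<alpha>;
          q = mubar / reagm_Lhat L \<alpha>
      in ((m - s) + sqrt ((s - m)\<^sup>2 + 4 * m * q)) / (2 * m))"

text \<open>
  One step of RE-AGM on the pair \<open>(x\<^sup>k, u\<^sup>k)\<close>, where \<open>g\<close> is the inexact gradient.
\<close>

definition reagm_step ::
  "real \<Rightarrow> real \<Rightarrow> real \<Rightarrow> ('a::real_vector \<Rightarrow> 'a) \<Rightarrow> 'a \<times> 'a \<Rightarrow> 'a \<times> 'a" where
  "reagm_step L mubar \<alpha> g = (\<lambda>(x, u).
     let a = reagm_a L mubar \<alpha>;
         y = (a *\<^sub>R u + x) /\<^sub>R (1 + a)
     in (y - reagm_h L \<alpha> *\<^sub>R g y,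
         (1 - a) *\<^sub>R u + a *\<^sub>R y - (a / mubar) *\<^sub>R g y))"

definition reagm_x ::
  "real \<Rightarrow> real \<Rightarrow> 'a::real_vector \<Rightarrow> real \<Rightarrow> ('a \<Rightarrow> 'a) \<Rightarrow> nat \<Rightarrow> 'a" where
  "reagm_x L mubar x_start \<alpha> g k = fst ((reagm_step L mubar \<alpha> g ^^ k) (x_start, x_start))"

end

theory Submission
  imports Defs
begin

text \<open>
  The Lyapunov function is \<open>\<Phi> = f x - f x\<^sup>* + \<mu>/4 \<parallel>u - x\<^sup>*\<parallel>\<^sup>2\<close>. One step of the method gives
  \<open>\<Phi>\<^sup>+ \<le> (1 - a) \<Phi>\<close> with room to spare: the error term \<open>-\<langle>e, v\<rangle>\<close> is absorbed by the half of the
  strong convexity that the choice \<open>\<mu>/2\<close> leaves unused, and multiples of \<open>\<parallel>\<nabla>f(y)\<parallel>\<^sup>2\<close> and \<open>\<parallel>u - y\<parallel>\<^sup>2\<close>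
  remain. The factor \<open>1 - a\<close> alone would not suffice, since \<open>a\<close> is slightly below the claimed rate
  when \<open>\<mu> = L\<close>. As the two remaining terms dominate a multiple of \<open>\<Phi>\<^sup>+\<close>, the factor improves to
  \<open>(1 - a) / (1 + a\<^sup>2 (1 - a))\<close>, which is enough.
\<close>

section \<open>Consequences of the quadratic upper and lower bounds on \<open>f\<close>\<close>

text \<open>A gradient step of size \<open>1 / L\<close> from \<open>xstar\<close> lowers
  \<open>f\<close> by at least \<open>(norm (gf xstar))\<^sup>2 / (2 * L)\<close>, which minimality
  permits only if the gradient vanishes.\<close>

lemma minimizer_gradient_zero:
  fixes gf :: "'a::real_inner \<Rightarrow> 'a"
  assumes "0 < L" and ssc: "smooth_strongly_convex L \<mu> f gf" and min: "\<And>x. f xstar \<le> f x"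
  shows "gf xstar = 0"
proof -
  define y X where "y = xstar - (1 / L) *\<^sub>R gf xstar" and "X = (norm (gf xstar))\<^sup>2 / L"
  have "f y - f xstar - inner (gf xstar) (y - xstar) \<le> L / 2 * (norm (y - xstar))\<^sup>2"
    using ssc unfolding smooth_strongly_convex_def by blast
  moreover have "inner (gf xstar) (y - xstar) = - X"
    by (simp add: y_def X_def power2_norm_eq_inner)
  moreover have "L / 2 * (norm (y - xstar))\<^sup>2 = X / 2"
    using \<open>0 < L\<close> by (simp add: y_def X_def power_divide power2_eq_square)
  ultimately have "X \<le> 0"
    using min[of y] by linarith
  then show ?thesis
    using \<open>0 < L\<close> by (simp add: X_def divide_le_0_iff)
qed

text \<open>Strong convexity at \<open>y\<close> bounds \<open>f z\<close> below by a quadratic in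
  \<open>z\<close>; completing the square gives the minimum of that quadratic.\<close>

lemma polyak_lojasiewicz:
  fixes gf :: "'a::real_inner \<Rightarrow> 'a"
  assumes "0 < \<mu>" and ssc: "smooth_strongly_convex L \<mu> f gf"
  shows "2 * \<mu> * (f y - f z) \<le> (norm (gf y))\<^sup>2"
proof -
  have "\<mu> / 2 * (norm (z - y))\<^sup>2 \<le> f z - f y - inner (gf y) (z - y)"
    using ssc unfolding smooth_strongly_convex_def by blast
  then have lower: "2 * \<mu> * (\<mu> / 2 * (norm (z - y))\<^sup>2) \<le> 2 * \<mu> * (f z - f y - inner (gf y) (z - y))"
    using \<open>0 < \<mu>\<close> by (intro mult_left_mono) auto
  have "0 \<le> (norm (gf y + \<mu> *\<^sub>R (z - y)))\<^sup>2"
    by simp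
  also have "(norm (gf y + \<mu> *\<^sub>R (z - y)))\<^sup>2
      = (norm (gf y))\<^sup>2 + 2 * \<mu> * inner (gf y) (z - y) + \<mu>\<^sup>2 * (norm (z - y))\<^sup>2"
    unfolding power2_norm_eq_inner
    by (simp only: inner_add_left inner_add_right inner_scaleR_left inner_scaleR_right
        inner_commute[of "z - y" "gf y"]) (simp add: power2_eq_square distrib_left)
  finally have "0 \<le> (norm (gf y))\<^sup>2 + 2 * \<mu> * inner (gf y) (z - y) + \<mu>\<^sup>2 * (norm (z - y))\<^sup>2" .
  with lower show ?thesis
    by (simp add: algebra_simps power2_eq_square)
qed

text \<open>Adding the strong convexity bounds from \<open>xstar\<close> to \<open>y\<close> and
  back gives strong monotonicity of the gradient; Cauchy-Schwarz then cancels one factor of the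
  distance.\<close>

lemma distance_minimizer_le_gradient:
  fixes gf :: "'a::real_inner \<Rightarrow> 'a"
  assumes "0 < \<mu>" and ssc: "smooth_strongly_convex L \<mu> f gf" and "gf xstar = 0"
  shows "\<mu> * norm (y - xstar) \<le> norm (gf y)"
proof -
  have "\<mu> / 2 * (norm (y - xstar))\<^sup>2 \<le> f y - f xstar - inner (gf xstar) (y - xstar)"
    "\<mu> / 2 * (norm (xstar - y))\<^sup>2 \<le> f xstar - f y - inner (gf y) (xstar - y)"
    using ssc unfolding smooth_strongly_convex_def by blast+
  then have "\<mu> * (norm (y - xstar))\<^sup>2 \<le> inner (gf y) (y - xstar)"
    using \<open>gf xstar = 0\<close> by (simp add: norm_minus_commute inner_diff_right)
  also have "\<dots> \<le> norm (gf y) * norm (y - xstar)"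
    by (rule norm_cauchy_schwarz)
  finally show ?thesis
    by (cases "y = xstar") (simp_all add: power2_eq_square)
qed

section \<open>Descent with a relatively inexact gradient\<close>

text \<open>Since \<open>g\<close> lies in the ball of radius \<open>\<alpha> * norm G\<close>
  around \<open>G\<close>, the cosine of their angle is at least
  \<open>sqrt (1 - \<alpha>\<^sup>2)\<close> and \<open>norm g\<close> is at least
  \<open>(1 - \<alpha>) * norm G\<close>. The product form is the one that matches the step size
  \<open>reagm_h\<close>.\<close>

lemma relative_error_inner_ge:
  fixes G g :: "'a::real_inner"
  assumes "0 \<le> \<alpha>" "\<alpha> < 1" and err: "norm (g - G) \<le> \<alpha> * norm G"
  shows "sqrt (1 - \<alpha>\<^sup>2) * (1 - \<alpha>) * (norm G)\<^sup>2 \<le> inner G g"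
proof -
  define r where "r = sqrt (1 - \<alpha>\<^sup>2)"
  have "0 \<le> 1 - \<alpha>\<^sup>2"
    using assms(1,2) by (simp add: power_le_one)
  then have r: "0 \<le> r" "r\<^sup>2 = 1 - \<alpha>\<^sup>2"
    by (auto simp: r_def)
  have "norm G \<le> norm (g - G) + norm g"
    by (metis norm_minus_commute norm_triangle_sub add.commute)
  then have low: "(1 - \<alpha>) * norm G \<le> norm g"
    using err by (simp add: algebra_simps)
  have "(norm (g - G))\<^sup>2 \<le> (\<alpha> * norm G)\<^sup>2"
    using err by (intro power_mono) auto
  moreover have "(norm (g - G))\<^sup>2 = (norm g)\<^sup>2 - 2 * inner G g + (norm G)\<^sup>2"
    by (simp add: power2_norm_eq_inner inner_diff_left inner_diff_right inner_commute)
  ultimately have "(norm g)\<^sup>2 + (1 - \<alpha>\<^sup>2) * (norm G)\<^sup>2 \<le> 2 * inner G g"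
    by (simp add: algebra_simps)
  \<comment> \<open>AM-GM turns the sum of squares into a product, which is the cosine
    bound.\<close>
  moreover have "2 * (r * norm G * norm g) \<le> (norm g)\<^sup>2 + (r * norm G)\<^sup>2"
    using sum_squares_bound[of "r * norm G" "norm g"] by simp
  ultimately have "r * norm G * norm g \<le> inner G g"
    by (simp add: power_mult_distrib r)
  moreover have "r * norm G * ((1 - \<alpha>) * norm G) \<le> r * norm G * norm g"
    using low r by (intro mult_left_mono) auto
  ultimately show ?thesis
    unfolding r_def by (simp add: power2_eq_square mult_ac)
qed

text \<open>With the lower bound on \<open>inner G g\<close> and the upper bound on
  \<open>norm g\<close>, smoothness guarantees a decrease that is a concave quadratic in the step
  size. \<open>reagm_h\<close> is its maximizer and \<open>1 / (2 * reagm_Lhat L \<alpha>)\<close>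
  its maximal value, in units of the squared gradient norm.\<close>

lemma relative_error_descent:
  fixes gf :: "'a::real_inner \<Rightarrow> 'a"
  assumes "0 < L" "0 \<le> \<alpha>" "\<alpha> < 1" and ssc: "smooth_strongly_convex L \<mu> f gf"
    and err: "norm (g - gf y) \<le> \<alpha> * norm (gf y)"
  shows "f (y - reagm_h L \<alpha> *\<^sub>R g) \<le> f y - (norm (gf y))\<^sup>2 / (2 * reagm_Lhat L \<alpha>)"
proof -
  define G h r where "G = gf y" and "h = reagm_h L \<alpha>" and "r = sqrt (1 - \<alpha>\<^sup>2)"
  let ?\<rho> = "(1 - \<alpha>) / (1 + \<alpha>)"
  have rho: "0 < ?\<rho>"
    using assms by simp
  have r_pos: "0 < r"
    unfolding r_def real_sqrt_gt_0_iff using assms by (simp add: abs_square_less_1)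
  have r2: "r\<^sup>2 = (1 - \<alpha>) * (1 + \<alpha>)"
    using r_pos unfolding r_def by (simp add: power2_eq_square algebra_simps)
  \<comment> \<open>Expressing the power 3/2 through \<open>r\<close> makes \<open>h\<close>
    rational in \<open>r\<close> and \<alpha>.\<close>
  have "sqrt ?\<rho> = r / (1 + \<alpha>)"
    using r_pos r2 assms by (intro real_sqrt_unique) (auto simp: power_divide power2_eq_square)
  moreover have "?\<rho> powr (3 / 2) = ?\<rho> * sqrt ?\<rho>"
    using rho powr_add[of ?\<rho> 1 "1 / 2"] by (simp add: powr_half_sqrt del: abs_divide)
  ultimately have h: "h = (1 - \<alpha>) * r / (L * (1 + \<alpha>)\<^sup>2)"
    by (simp add: h_def reagm_h_def power2_eq_square)
  have h_pos: "0 \<le> h"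
    unfolding h using assms r_pos by simp
  have "norm g \<le> norm (g - G) + norm G"
    by (metis norm_triangle_sub add.commute)
  then have "norm g \<le> (1 + \<alpha>) * norm G"
    using err by (simp add: G_def algebra_simps)
  then have "(norm g)\<^sup>2 \<le> ((1 + \<alpha>) * norm G)\<^sup>2"
    by (intro power_mono) auto
  then have up: "L / 2 * h\<^sup>2 * (norm g)\<^sup>2 \<le> L / 2 * h\<^sup>2 * (1 + \<alpha>)\<^sup>2 * (norm G)\<^sup>2"
    using \<open>0 < L\<close> by (simp add: power_mult_distrib mult.assoc mult_left_mono)
  have low: "h * (r * (1 - \<alpha>) * (norm G)\<^sup>2) \<le> h * inner G g"
    using relative_error_inner_ge[OF assms(2,3) err] h_pos
    unfolding G_def r_def by (intro mult_left_mono) auto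
  have "f (y - h *\<^sub>R g) - f y - inner G ((y - h *\<^sub>R g) - y) \<le> L / 2 * (norm ((y - h *\<^sub>R g) - y))\<^sup>2"
    using ssc unfolding smooth_strongly_convex_def G_def by blast
  then have "f (y - h *\<^sub>R g) \<le> f y - h * inner G g + L / 2 * h\<^sup>2 * (norm g)\<^sup>2"
    by (simp add: power_mult_distrib)
  also have "\<dots> \<le> f y - (h * (r * (1 - \<alpha>)) - L / 2 * h\<^sup>2 * (1 + \<alpha>)\<^sup>2) * (norm G)\<^sup>2"
    using up low by (simp only: left_diff_distrib mult.assoc)
  \<comment> \<open>As \<open>h\<close> is the vertex of the parabola, the quadratic term is half of
    the linear one.\<close>
  also have "h * (r * (1 - \<alpha>)) - L / 2 * h\<^sup>2 * (1 + \<alpha>)\<^sup>2 = 1 / (2 * reagm_Lhat L \<alpha>)"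
  proof -
    have "r\<^sup>2 * (1 - \<alpha>)\<^sup>2 = (1 + \<alpha>) * (1 - \<alpha>) ^ 3" "L * (1 + \<alpha>)\<^sup>2 = (1 + \<alpha>) * (L * (1 + \<alpha>))"
      unfolding r2 by (simp_all add: power2_eq_square power3_eq_cube)
    then have r_cancel: "r\<^sup>2 * (1 - \<alpha>)\<^sup>2 / (L * (1 + \<alpha>)\<^sup>2) = (1 - \<alpha>) ^ 3 / (L * (1 + \<alpha>))"
      using assms by simp
    have "h * (r * (1 - \<alpha>)) = r\<^sup>2 * (1 - \<alpha>)\<^sup>2 / (L * (1 + \<alpha>)\<^sup>2)"
      unfolding h by (simp add: power2_eq_square)
    also note r_cancel
    finally have 1: "h * (r * (1 - \<alpha>)) = (1 - \<alpha>) ^ 3 / (L * (1 + \<alpha>))" .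
    have "h * (L * (1 + \<alpha>)\<^sup>2) = (1 - \<alpha>) * r"
      unfolding h using assms by simp
    then have 2: "L * h\<^sup>2 * (1 + \<alpha>)\<^sup>2 = h * (r * (1 - \<alpha>))"
      by (simp add: power2_eq_square mult_ac)
    have "1 / (2 * reagm_Lhat L \<alpha>) = 1 / 2 * ((1 - \<alpha>) ^ 3 / (L * (1 + \<alpha>)))"
      by (simp add: reagm_Lhat_def)
    then show ?thesis
      using 1 2 by linarith
  qed
  finally show ?thesis
    by (simp add: G_def h_def)
qed

section \<open>One-step contraction of the Lyapunov function\<close>

text \<open>Young's inequality; \<open>e\<close> will be the gradient error, and the weight
  \<open>M\<close> matches the reserve left by strong convexity.\<close>

lemma neg_inner_le_weighted:
  fixes e w :: "'a::real_inner"
  assumes "0 < M"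
  shows "- inner e w \<le> M / 2 * (norm w)\<^sup>2 + (norm e)\<^sup>2 / (2 * M)"
proof -
  have "0 \<le> (norm (e + M *\<^sub>R w))\<^sup>2 / (2 * M)"
    using assms by simp
  also have "(norm (e + M *\<^sub>R w))\<^sup>2 = (norm e)\<^sup>2 + 2 * M * inner e w + M\<^sup>2 * (norm w)\<^sup>2"
    unfolding power2_norm_eq_inner
    by (simp add: inner_add_left inner_add_right inner_commute power2_eq_square algebra_simps)
  finally show ?thesis
    using assms by (simp add: field_simps power2_eq_square)
qed

lemma lyapunov_step:
  fixes gf :: "'a::real_inner \<Rightarrow> 'a"
  assumes "0 < M" "0 < a" "a \<le> \<alpha>" "\<alpha> \<le> 1 / 3"
    and ssc: "smooth_strongly_convex L (2 * M) f gf"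
    and grad: "gf xstar = 0" and min: "\<And>x. f xstar \<le> f x"
    and err: "norm (g - gf y) \<le> \<alpha> * norm (gf y)"
    and y: "(1 + a) *\<^sub>R y = a *\<^sub>R u + x"
    and u': "u' = (1 - a) *\<^sub>R u + a *\<^sub>R y - (a / M) *\<^sub>R g"
    and root: "M / Lh = (1 - 2 * \<alpha>) * a\<^sup>2 + (4 * \<alpha> + 2 * \<alpha>\<^sup>2) * a"
    and descent: "f x' \<le> f y - (norm (gf y))\<^sup>2 / (2 * Lh)"
  shows "(1 + a\<^sup>2 * (1 - a)) * (f x' - f xstar + M / 2 * (norm (u' - xstar))\<^sup>2)
    \<le> (1 - a) * (f x - f xstar + M / 2 * (norm (u - xstar))\<^sup>2)"
proof -
  define G w d e v where "G = gf y" and "w = y - xstar" and "d = u - y" and "e = g - G"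
    and "v = w + (1 - a) *\<^sub>R d"
  \<comment> \<open>\<open>A\<close> and \<open>D\<close> scale like function values; every surplus
    term is expressed in them.\<close>
  define A where "A = (norm G)\<^sup>2 / M"
  define D where "D = M * (norm d)\<^sup>2"
  have a1: "a < 1"
    using assms by simp
  have xy: "x - y = - (a *\<^sub>R d)"
    using y by (simp add: d_def algebra_simps)
  have A0: "0 \<le> A" and D0: "0 \<le> D"
    using \<open>0 < M\<close> by (simp_all add: A_def D_def)
  have "2 * M / 2 * (norm (xstar - y))\<^sup>2 \<le> f xstar - f y - inner G (xstar - y)"
    "2 * M / 2 * (norm (x - y))\<^sup>2 \<le> f x - f y - inner G (x - y)"
    using ssc unfolding smooth_strongly_convex_def G_def by blast+
  then have c1: "M * (norm w)\<^sup>2 \<le> f xstar - f y + inner G w"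
    and c2: "a\<^sup>2 * D \<le> f x - f y + a * inner G d"
    unfolding xy by (simp_all add: w_def D_def norm_minus_commute inner_diff_right power_mult_distrib mult_ac)
  have "2 * (2 * M) * (f y - f xstar) \<le> (norm G)\<^sup>2"
    using polyak_lojasiewicz[OF _ ssc] \<open>0 < M\<close> by (simp add: G_def)
  then have PL: "f y - f xstar \<le> A / 4"
    using \<open>0 < M\<close> by (simp add: A_def field_simps)
  have "2 * M * norm w \<le> norm G"
    using distance_minimizer_le_gradient[OF _ ssc grad] \<open>0 < M\<close> by (simp add: G_def w_def)
  then have w_le: "norm w \<le> norm G / M / 2"
    using \<open>0 < M\<close> by (simp add: field_simps)
  have "norm e \<le> \<alpha> * norm G"
    using err by (simp add: e_def G_def)
  then have e2: "(norm e)\<^sup>2 / M \<le> \<alpha>\<^sup>2 * A"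
    using power_mono[of "norm e" "\<alpha> * norm G" 2] \<open>0 < M\<close>
    by (simp add: A_def power_mult_distrib divide_right_mono)
  have "norm g \<le> norm (g - G) + norm G"
    by (metis norm_triangle_sub add.commute)
  then have g_le: "norm g \<le> (1 + \<alpha>) * norm G"
    using err by (simp add: G_def algebra_simps)
  then have g2: "(norm g)\<^sup>2 / M \<le> (1 + \<alpha>)\<^sup>2 * A"
    using power_mono[of "norm g" "(1 + \<alpha>) * norm G" 2] \<open>0 < M\<close>
    by (simp add: A_def power_mult_distrib divide_right_mono)
  have u'v: "u' - xstar = v - (a / M) *\<^sub>R g"
    unfolding u' v_def w_def d_def by (simp add: algebra_simps)
  have gv: "inner g v = inner G w + (1 - a) * inner G d + inner e w + (1 - a) * inner e d"
    unfolding v_def e_def by (simp add: inner_diff_left inner_add_right algebra_simps)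
  \<comment> \<open>\<open>v\<close> is the convex combination of \<open>u - xstar\<close> and
    \<open>w\<close> with weights \<open>1 - a\<close> and \<open>a\<close>.\<close>
  have v2: "(norm v)\<^sup>2 = (1 - a) * (norm (u - xstar))\<^sup>2 + a * (norm w)\<^sup>2 - a * (1 - a) * (norm d)\<^sup>2"
  proof -
    have "u - xstar = w + d"
      by (simp add: w_def d_def)
    then show ?thesis
      unfolding v_def power2_norm_eq_inner
      by (simp add: inner_add_left inner_add_right inner_commute power2_eq_square algebra_simps)
  qed
  have "(norm (u' - xstar))\<^sup>2 = (norm v)\<^sup>2 - 2 * (a / M) * inner g v + (a / M)\<^sup>2 * (norm g)\<^sup>2"
    unfolding u'v power2_norm_eq_inner
    by (simp add: inner_diff_left inner_diff_right inner_commute power2_eq_square)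
  then have "M / 2 * (norm (u' - xstar))\<^sup>2
      = M / 2 * (norm v)\<^sup>2 - a * inner g v + a\<^sup>2 / 2 * ((norm g)\<^sup>2 / M)"
    using \<open>0 < M\<close> by (simp add: field_simps power2_eq_square)
  also have "a\<^sup>2 / 2 * ((norm g)\<^sup>2 / M) \<le> a\<^sup>2 / 2 * ((1 + \<alpha>)\<^sup>2 * A)"
    using g2 by (intro mult_left_mono) auto
  finally have U: "M / 2 * (norm (u' - xstar))\<^sup>2
      \<le> M / 2 * (norm v)\<^sup>2 - a * inner g v + a\<^sup>2 / 2 * ((1 + \<alpha>)\<^sup>2 * A)"
    by simp
  have "- inner e w \<le> M / 2 * (norm w)\<^sup>2 + 1 / 2 * ((norm e)\<^sup>2 / M)"
    using neg_inner_le_weighted[OF \<open>0 < M\<close>, of e w] by simp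
  then have ew: "- inner e w \<le> M / 2 * (norm w)\<^sup>2 + \<alpha>\<^sup>2 * A / 2"
    using mult_left_mono[OF e2, of "1 / 2"] by simp
  have "- inner e d \<le> D / 2 + 1 / 2 * ((norm e)\<^sup>2 / M)"
    using neg_inner_le_weighted[OF \<open>0 < M\<close>, of e d] by (simp add: D_def)
  then have ed: "- inner e d \<le> D / 2 + \<alpha>\<^sup>2 * A / 2"
    using mult_left_mono[OF e2, of "1 / 2"] by simp
  have desc: "f x' \<le> f y - ((1 - 2 * \<alpha>) * a\<^sup>2 + (4 * \<alpha> + 2 * \<alpha>\<^sup>2) * a) * A / 2"
  proof -
    have "(norm (gf y))\<^sup>2 / (2 * Lh) = M / Lh * A / 2"
      using \<open>0 < M\<close> by (simp add: A_def G_def)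
    then show ?thesis
      using descent root by simp
  qed
  \<comment> \<open>Strong convexity at \<open>y\<close> is used towards \<open>xstar\<close> with
    weight \<open>a\<close> and towards \<open>x\<close> with weight \<open>1 - a\<close>. In
    \<open>M * (norm w)\<^sup>2\<close> the coefficients \<open>a / 2\<close> (from
    \<open>v2\<close>), \<open>- a\<close> (from \<open>c1\<close>) and \<open>a / 2\<close> (from
    \<open>ew\<close>) cancel. The \<open>D / 2\<close> terms of \<open>v2\<close> and
    \<open>ed\<close> cancel too, leaving the contribution of \<open>c2\<close>. The equation
    \<open>root\<close> makes the coefficient of \<open>A\<close> exactly
    \<open>- 2 * \<alpha> * a * (1 - a)\<close>.\<close>
  have main: "f x' - f xstar + M / 2 * (norm (u' - xstar))\<^sup>2
      \<le> (1 - a) * (f x - f xstar + M / 2 * (norm (u - xstar))\<^sup>2)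
        - 2 * \<alpha> * a * (1 - a) * A - a\<^sup>2 * (1 - a) * D"
  proof -
    have "0 \<le> a" "0 \<le> 1 - a" "0 \<le> a * (1 - a)"
      using \<open>0 < a\<close> a1 by auto
    note mult_left_mono[OF c1 this(1)] mult_left_mono[OF c2 this(2)]
      mult_left_mono[OF ew this(1)] mult_left_mono[OF ed this(3)]
    then show ?thesis
      using U desc unfolding v2 gv D_def by (simp add: field_simps power2_eq_square)
  qed
  \<comment> \<open>Both \<open>w\<close> and the gradient step have norm at most
    \<open>norm G / M / 2\<close>, the latter because \<open>a * (1 + \<alpha>)\<close> is at most
    4/9.\<close>
  have U_le: "M / 2 * (norm (u' - xstar))\<^sup>2 \<le> A + D"
  proof -
    have "norm v \<le> norm w + norm ((1 - a) *\<^sub>R d)"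
      unfolding v_def by (rule norm_triangle_ineq)
    also have "norm ((1 - a) *\<^sub>R d) \<le> norm d"
      using \<open>0 < a\<close> a1 by (simp add: mult_left_le_one_le)
    finally have "norm v \<le> norm G / M / 2 + norm d"
      using w_le by simp
    moreover have "norm ((a / M) *\<^sub>R g) \<le> norm G / M / 2"
    proof -
      have "a * norm g \<le> 1 / 3 * (4 / 3 * norm G)"
        using g_le assms by (intro mult_mono order.trans[OF g_le]) auto
      also have "\<dots> \<le> norm G / 2"
        by simp
      finally show ?thesis
        using \<open>0 < M\<close> \<open>0 < a\<close> by (simp add: field_simps)
    qed
    ultimately have "norm (u' - xstar) \<le> norm G / M + norm d"
      unfolding u'v using norm_triangle_ineq4[of v "(a / M) *\<^sub>R g"] by linarith
    then have "(norm (u' - xstar))\<^sup>2 \<le> (norm G / M + norm d)\<^sup>2"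
      by (intro power_mono) auto
    also have "\<dots> \<le> 2 * (norm G / M)\<^sup>2 + 2 * (norm d)\<^sup>2"
      using sum_squares_bound[of "norm G / M" "norm d"] by (simp add: power2_sum)
    finally have "M / 2 * (norm (u' - xstar))\<^sup>2 \<le> M / 2 * (2 * (norm G / M)\<^sup>2 + 2 * (norm d)\<^sup>2)"
      using \<open>0 < M\<close> by (intro mult_left_mono) auto
    also have "\<dots> = A + D"
      using \<open>0 < M\<close> by (simp add: A_def D_def field_simps power2_eq_square)
    finally show ?thesis .
  qed
  have "0 \<le> ((1 - 2 * \<alpha>) * a\<^sup>2 + (4 * \<alpha> + 2 * \<alpha>\<^sup>2) * a) * A / 2"
    using assms A0 by simp
  \<comment> \<open>Of the factor 5/4, one quarter comes from \<open>PL\<close> and the rest from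
    \<open>U_le\<close>.\<close>
  then have "f x' - f xstar + M / 2 * (norm (u' - xstar))\<^sup>2 \<le> 5 / 4 * A + D"
    using desc PL U_le by linarith
  then have "a\<^sup>2 * (1 - a) * (f x' - f xstar + M / 2 * (norm (u' - xstar))\<^sup>2)
      \<le> a\<^sup>2 * (1 - a) * (5 / 4 * A + D)"
    using a1 by (intro mult_left_mono) auto
  also have "\<dots> \<le> 2 * \<alpha> * a * (1 - a) * A + a\<^sup>2 * (1 - a) * D"
  proof -
    \<comment> \<open>Here \<open>a \<le> \<alpha>\<close> enters: the surplus in \<open>A\<close>
      is of order \<open>\<alpha> * a\<close>, the demand only of order
      \<open>a\<^sup>2\<close>.\<close>
    have "a * (1 - a) * A * (5 / 4 * a) \<le> a * (1 - a) * A * (2 * \<alpha>)"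
      using assms A0 a1 by (intro mult_left_mono) auto
    then show ?thesis
      by (simp add: algebra_simps power2_eq_square)
  qed
  finally show ?thesis
    unfolding distrib_right mult_1_left using main by linarith
qed

section \<open>The parameter \<open>a\<close> and the convergence rate\<close>

text \<open>With \<open>t = s - m\<close>, solving the formula for the square root \<open>S\<close>
  and squaring recovers the quadratic; positivity holds because \<open>S\<close> exceeds
  \<open>t\<close>.\<close>

lemma reagm_a_root:
  assumes "0 < L" "0 < M" "0 < \<alpha>" "\<alpha> \<le> 1 / 3"
  defines "a \<equiv> reagm_a L M \<alpha>"
  shows "0 < a"
    and "M / reagm_Lhat L \<alpha> = (1 - 2 * \<alpha>) * a\<^sup>2 + (4 * \<alpha> + 2 * \<alpha>\<^sup>2) * a"
proof -
  define m t q where "m = 1 - 2 * \<alpha>" and "t = 4 * \<alpha> + 2 * \<alpha>\<^sup>2" and "q = M / reagm_Lhat L \<alpha>"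
  have pos: "0 < m" "0 < t" "0 < q"
    using assms by (simp_all add: m_def t_def q_def reagm_Lhat_def add_pos_nonneg)
  define S where "S = sqrt (t\<^sup>2 + 4 * m * q)"
  have S2: "S\<^sup>2 = t\<^sup>2 + 4 * m * q" and S: "t < S"
    using pos by (simp_all add: S_def real_less_rsqrt)
  have a: "a = (S - t) / (2 * m)"
    unfolding a_def reagm_a_def Let_def S_def q_def m_def t_def by (simp add: algebra_simps)
  show "0 < a"
    using a S pos by simp
  have "S = 2 * m * a + t"
    using a pos by (simp add: field_simps)
  then have "4 * m * q = 4 * m * (m * a\<^sup>2 + t * a)"
    using S2 by (simp add: power2_eq_square algebra_simps)
  then have "q = m * a\<^sup>2 + t * a"
    using pos by simp
  then show "M / reagm_Lhat L \<alpha> = (1 - 2 * \<alpha>) * a\<^sup>2 + (4 * \<alpha> + 2 * \<alpha>\<^sup>2) * a"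
    by (simp add: q_def m_def t_def)
qed

text \<open>These are the endpoint cases \<open>a = 0\<close> and \<open>a = \<alpha>\<close> of the
  affine inequality in \<open>rate_bound\<close>, divided by \<alpha> and cleared of the denominator
  \<open>1 + \<alpha>\<close>.\<close>

lemma cubic_bound:
  fixes \<alpha> :: real
  assumes "0 \<le> \<alpha>" "\<alpha> \<le> 1 / 3"
  shows "(4 + 2 * \<alpha>) * (1 + \<alpha>) \<le> 21 * (1 - \<alpha>) ^ 3"
    and "5 * (1 + \<alpha>) \<le> (21 + 42 / 5 * \<alpha>) * (1 - \<alpha>) ^ 3"
proof -
  have "(2 / 3) ^ 3 \<le> (1 - \<alpha>) ^ 3"
    using assms by (intro power_mono) auto
  then have c: "8 / 27 \<le> (1 - \<alpha>) ^ 3"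
    by (simp add: power3_eq_cube)
  have "(4 + 2 * \<alpha>) * (1 + \<alpha>) \<le> (4 + 2 / 3) * (4 / 3)"
    using assms by (intro mult_mono) auto
  then show "(4 + 2 * \<alpha>) * (1 + \<alpha>) \<le> 21 * (1 - \<alpha>) ^ 3"
    using c by simp
  \<comment> \<open>Expansion about \<alpha> = 1/3: the cube is bounded below by its first-order
    part in \<open>d\<close>.\<close>
  define d where "d = 1 / 3 - \<alpha>"
  have d: "0 \<le> d" "d \<le> 1 / 3" and \<alpha>: "\<alpha> = 1 / 3 - d"
    using assms by (auto simp: d_def)
  have "d\<^sup>2 \<le> 1 / 3 * d"
    using d mult_right_mono[of d "1 / 3" d] by (simp add: power2_eq_square)
  then have "5 * (1 + \<alpha>) \<le> (21 + 42 / 5 * \<alpha>) * (8 / 27 + 4 / 3 * d)"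
    using d unfolding \<alpha> by (simp add: field_simps power2_eq_square)
  also have "\<dots> \<le> (21 + 42 / 5 * \<alpha>) * (1 - \<alpha>) ^ 3"
  proof (intro mult_left_mono)
    have "(1 - \<alpha>) ^ 3 = 8 / 27 + 4 / 3 * d + 2 * d\<^sup>2 + d ^ 3"
      unfolding \<alpha> by (simp add: field_simps power2_eq_square power3_eq_cube)
    then show "8 / 27 + 4 / 3 * d \<le> (1 - \<alpha>) ^ 3"
      using d by simp
  qed (use assms in auto)
  finally show "5 * (1 + \<alpha>) \<le> (21 + 42 / 5 * \<alpha>) * (1 - \<alpha>) ^ 3" .
qed

text \<open>Here \<kappa> stands for \<mu>/L and \<open>p\<close> for its power 1/2 + \<tau>. The
  exponent \<tau> enters only through \<open>\<alpha> * p = \<kappa> / 3\<close> and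
  \<open>\<kappa> \<le> 9 * \<alpha>\<^sup>2\<close>, so real powers disappear.\<close>

lemma rate_bound:
  fixes a b \<alpha> \<kappa> p :: real
  assumes "0 < \<alpha>" "\<alpha> \<le> 1 / 3" "0 < a"
    and p: "\<alpha> * p = \<kappa> / 3" and "\<kappa> \<le> 9 * \<alpha>\<^sup>2" and "0 < \<kappa>"
    and root: "\<kappa> / 2 * (1 - \<alpha>) ^ 3 / (1 + \<alpha>) = (1 - 2 * \<alpha>) * a\<^sup>2 + (4 * \<alpha> + 2 * \<alpha>\<^sup>2) * a"
  shows "a \<le> \<alpha>"
    and "1 - a \<le> (1 - 1 / (10 * sqrt 2) * p) * (1 + a\<^sup>2 * (1 - a))"
proof -
  show a_le: "a \<le> \<alpha>"
  \<comment> \<open>The right side of \<open>root\<close> increases in \<open>a\<close> and equals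
    \<open>5 * \<alpha>\<^sup>2\<close> at \<open>a = \<alpha>\<close>, while the left side is at
    most \<open>9 / 2 * \<alpha>\<^sup>2\<close>.\<close>
  proof (rule ccontr)
    assume "\<not> a \<le> \<alpha>"
    then have less: "\<alpha> < a" by simp
    have "\<kappa> / 2 * (1 - \<alpha>) ^ 3 / (1 + \<alpha>) \<le> \<kappa> / 2"
    proof -
      have "(1 - \<alpha>) ^ 3 \<le> 1 + \<alpha>"
        using assms power_le_one[of "1 - \<alpha>" 3] by linarith
      then have "\<kappa> / 2 * (1 - \<alpha>) ^ 3 \<le> \<kappa> / 2 * (1 + \<alpha>)"
        using assms by (intro mult_left_mono) auto
      then show ?thesis
        using assms by (simp add: field_simps)
    qed
    also have "\<dots> < 5 * \<alpha>\<^sup>2"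
      using \<open>\<kappa> \<le> 9 * \<alpha>\<^sup>2\<close> \<open>0 < \<alpha>\<close> zero_less_power[of \<alpha> 2] by linarith
    also have "\<dots> = (1 - 2 * \<alpha>) * \<alpha>\<^sup>2 + (4 * \<alpha> + 2 * \<alpha>\<^sup>2) * \<alpha>"
      by (simp add: algebra_simps power2_eq_square)
    also have "\<dots> \<le> (1 - 2 * \<alpha>) * a\<^sup>2 + (4 * \<alpha> + 2 * \<alpha>\<^sup>2) * a"
      using assms less by (intro add_mono mult_left_mono power_mono) auto
    finally show False
      using root by simp
  qed
  define b where "b = 1 / (10 * sqrt 2) * p"
  define c where "c = (1 - \<alpha>) ^ 3 / (1 + \<alpha>)"
  have c: "4 + 2 * \<alpha> \<le> 21 * c" "5 \<le> (21 + 42 / 5 * \<alpha>) * c"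
    using cubic_bound[of \<alpha>] assms by (simp_all add: c_def field_simps)
  have c0: "0 < c" using c assms by linarith
  have "0 < \<alpha> * p" using p \<open>0 < \<kappa>\<close> by simp
  then have "0 < b"
    using \<open>0 < \<alpha>\<close> by (simp add: b_def zero_less_mult_iff)
  \<comment> \<open>\<open>\<kappa> / 2\<close> equals \<open>15 * sqrt 2 * (\<alpha> * b)\<close>,
    and 21 is 15 times the rational lower bound 7/5 of \<open>sqrt 2\<close>.\<close>
  have "21 * (\<alpha> * b) \<le> \<kappa> / 2"
  proof -
    have "(7 / 5)\<^sup>2 \<le> (2::real)" by (simp add: power2_eq_square)
    then have s2: "7 / 5 \<le> sqrt 2" by (rule real_le_rsqrt)
    have "sqrt 2 * (\<alpha> * b) = \<kappa> / 30"
      using p by (simp add: b_def field_simps)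
    moreover have "7 / 5 * (\<alpha> * b) \<le> sqrt 2 * (\<alpha> * b)"
      using s2 \<open>0 < b\<close> \<open>0 < \<alpha>\<close> by (intro mult_right_mono) auto
    ultimately show ?thesis by linarith
  qed
  then have "21 * (\<alpha> * b) * c \<le> \<kappa> / 2 * c"
    using c0 by (intro mult_right_mono) auto
  also have "\<dots> = (1 - 2 * \<alpha>) * a\<^sup>2 + (4 * \<alpha> + 2 * \<alpha>\<^sup>2) * a"
    using root by (simp add: c_def)
  finally have up: "21 * (\<alpha> * b) * c \<le> \<dots>" .
  have "(1 - 2 * \<alpha>) * a + (4 * \<alpha> + 2 * \<alpha>\<^sup>2) \<le> 21 * \<alpha> * c * (1 + 2 / 5 * a)"
  proof -
    text \<open>Affine in \<open>a\<close>, so the endpoints \<open>a = 0\<close> and \<open>a = \<alpha>\<close> suffice.\<close>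
    have "(\<alpha> - a) * (4 + 2 * \<alpha>) \<le> (\<alpha> - a) * (21 * c)"
      "a * 5 \<le> a * ((21 + 42 / 5 * \<alpha>) * c)"
      using c a_le \<open>0 < a\<close> by (auto intro!: mult_left_mono)
    then show ?thesis
      by (simp add: algebra_simps power2_eq_square)
  qed
  then have "a * ((1 - 2 * \<alpha>) * a + (4 * \<alpha> + 2 * \<alpha>\<^sup>2)) \<le> a * (21 * \<alpha> * c * (1 + 2 / 5 * a))"
    using \<open>0 < a\<close> by (intro mult_left_mono) auto
  with up have "21 * \<alpha> * c * b \<le> 21 * \<alpha> * c * (a + 2 / 5 * a\<^sup>2)"
    by (simp add: algebra_simps power2_eq_square)
  \<comment> \<open>The claimed rate \<open>b\<close> may exceed \<open>a\<close>, but only to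
    second order, which the factor \<open>1 + a\<^sup>2 * (1 - a)\<close> compensates.\<close>
  then have b: "b \<le> a + 2 / 5 * a\<^sup>2"
    using c0 \<open>0 < \<alpha>\<close> by simp
  have a3: "a \<le> 1 / 3"
    using a_le assms by simp
  have "1 - a \<le> (1 - (a + 2 / 5 * a\<^sup>2)) * (1 + a\<^sup>2 * (1 - a))"
  proof -
    \<comment> \<open>This is the difference of the two sides divided by \<open>a\<^sup>2\<close>.
      The estimates below close with equality: 4/9 - 2/5 - (2/5)(1/9) = 0.\<close>
    have "(1 - a) - 2 / 5 - (2 / 5) * a\<^sup>2 * (1 - a) - a * (1 - a) \<ge> 0"
    proof -
      have "(2 / 3)\<^sup>2 \<le> (1 - a)\<^sup>2"
        using a3 by (intro power_mono) auto
      moreover have "a\<^sup>2 * (1 - a) \<le> (1 / 3)\<^sup>2 * 1"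
        using a3 \<open>0 < a\<close> by (intro mult_mono power_mono) auto
      ultimately show ?thesis
        by (simp add: field_simps power2_eq_square)
    qed
    then have "0 \<le> a\<^sup>2 * ((1 - a) - 2 / 5 - (2 / 5) * a\<^sup>2 * (1 - a) - a * (1 - a))"
      by simp
    then show ?thesis
      by (simp add: field_simps power2_eq_square)
  qed
  also have "\<dots> \<le> (1 - b) * (1 + a\<^sup>2 * (1 - a))"
    using b a3 by (intro mult_right_mono) auto
  finally show "1 - a \<le> (1 - 1 / (10 * sqrt 2) * p) * (1 + a\<^sup>2 * (1 - a))"
    by (simp add: b_def)
qed

section \<open>Iterating the contraction from the starting point\<close>

theorem theorem5:
  fixes f :: "real ^ 'n \<Rightarrow> real"
    and gf g :: "real ^ 'n \<Rightarrow> real ^ 'n"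
    and xstar x0 :: "real ^ 'n"
    and \<mu> L \<tau> \<alpha> R :: real
    and N :: nat
  assumes "0 < \<mu>" and "\<mu> \<le> L"
    and "\<And>x. GDERIV f x :> gf x"
    and "continuous_on UNIV gf"
    and "smooth_strongly_convex L \<mu> f gf"
    and "\<And>x. f xstar \<le> f x"
    and "0 \<le> \<tau>" and "\<tau> \<le> 1 / 2"
    and "\<alpha> = 1 / 3 * (\<mu> / L) powr (1 / 2 - \<tau>)"
    and "relative_error_gradient \<alpha> gf g"
    and "R = norm (x0 - xstar)"
  shows "f (reagm_x L (\<mu> / 2) x0 \<alpha> g N) - f xstar
           \<le> L * R\<^sup>2 * (1 - 1 / (10 * sqrt 2) * (\<mu> / L) powr (1 / 2 + \<tau>)) ^ N"
proof -
  define M a st where "M = \<mu> / 2" and "a = reagm_a L M \<alpha>"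
    and "st k = (reagm_step L M \<alpha> g ^^ k) (x0, x0)" for k
  define b where "b = 1 / (10 * sqrt 2) * (\<mu> / L) powr (1 / 2 + \<tau>)"
  define \<Phi> where "\<Phi> z = f (fst z) - f xstar + M / 2 * (norm (snd z - xstar))\<^sup>2" for z
  define \<kappa> where "\<kappa> = \<mu> / L"
  have L: "0 < L" and M: "0 < M"
    using assms by (simp_all add: M_def)
  have \<kappa>: "0 < \<kappa>" "\<kappa> \<le> 1"
    using assms by (simp_all add: \<kappa>_def)
  have \<alpha>: "0 < \<alpha>" "\<alpha> \<le> 1 / 3"
    unfolding assms(9) \<kappa>_def[symmetric] using assms(8) \<kappa> by (simp_all add: powr_le1)
  \<comment> \<open>The exponents 1/2 - \<tau> and 1/2 + \<tau> add up to 1.\<close>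
  have alpha_p: "\<alpha> * \<kappa> powr (1 / 2 + \<tau>) = \<kappa> / 3"
    unfolding assms(9) \<kappa>_def[symmetric] using \<kappa> by (simp add: powr_add[symmetric])
  have "9 * \<alpha>\<^sup>2 = \<kappa> powr (1 - 2 * \<tau>)"
    unfolding assms(9) \<kappa>_def[symmetric] by (simp add: power2_eq_square powr_add[symmetric])
  also have "\<dots> \<ge> \<kappa> powr 1"
    using \<kappa> assms(7) by (intro powr_mono') auto
  finally have kappa_le: "\<kappa> \<le> 9 * \<alpha>\<^sup>2"
    using \<kappa> by simp
  note root = reagm_a_root[OF L M \<alpha>, folded a_def]
  have "M / reagm_Lhat L \<alpha> = \<kappa> / 2 * (1 - \<alpha>) ^ 3 / (1 + \<alpha>)"
    by (simp add: M_def reagm_Lhat_def \<kappa>_def)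
  note rate = rate_bound[OF \<alpha> root(1) alpha_p kappa_le \<kappa>(1) root(2)[unfolded this]]
  have one_b: "1 - a \<le> (1 - b) * (1 + a\<^sup>2 * (1 - a))"
    using rate(2) by (simp add: b_def \<kappa>_def)
  have a: "0 < a" "a \<le> \<alpha>" "a < 1"
    using root(1) rate(1) \<alpha> by auto
  have pos: "0 < 1 + a\<^sup>2 * (1 - a)"
    using a by (simp add: add_pos_nonneg)
  \<comment> \<open>Otherwise the right side of \<open>one_b\<close> would be nonpositive, against
    \<open>a < 1\<close>. The sign is what lets the contraction be iterated.\<close>
  have b1: "0 \<le> 1 - b"
    using one_b a pos by (smt (verit) mult_nonpos_nonneg)
  have grad: "gf xstar = 0"
    using minimizer_gradient_zero[OF L assms(5,6)] .
  have \<Phi>_nonneg: "0 \<le> \<Phi> z" for z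
    using assms(6)[of "fst z"] M by (simp add: \<Phi>_def)
  have step: "\<Phi> (reagm_step L M \<alpha> g z) \<le> (1 - b) * \<Phi> z" for z
  proof -
    obtain x u where z: "z = (x, u)" by force
    define y where "y = (a *\<^sub>R u + x) /\<^sub>R (1 + a)"
    define x' u' where "x' = y - reagm_h L \<alpha> *\<^sub>R g y"
      and "u' = (1 - a) *\<^sub>R u + a *\<^sub>R y - (a / M) *\<^sub>R g y"
    have z': "reagm_step L M \<alpha> g z = (x', u')"
      by (simp add: z reagm_step_def Let_def x'_def u'_def y_def a_def)
    have err: "norm (g y - gf y) \<le> \<alpha> * norm (gf y)"
      using assms(10) by (simp add: relative_error_gradient_def)
    have ssc: "smooth_strongly_convex L (2 * M) f gf"
      using assms(5) by (simp add: M_def)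
    have y: "(1 + a) *\<^sub>R y = a *\<^sub>R u + x"
      using a by (simp add: y_def)
    have "f x' \<le> f y - (norm (gf y))\<^sup>2 / (2 * reagm_Lhat L \<alpha>)"
      unfolding x'_def using \<alpha> by (intro relative_error_descent[OF L _ _ assms(5) err]) auto
    then have "(1 + a\<^sup>2 * (1 - a)) * \<Phi> (x', u') \<le> (1 - a) * \<Phi> z"
      using lyapunov_step[OF M a(1,2) \<alpha>(2) ssc grad assms(6) err y u'_def root(2)]
      by (simp add: \<Phi>_def z)
    also have "\<dots> \<le> (1 - b) * (1 + a\<^sup>2 * (1 - a)) * \<Phi> z"
      using one_b \<Phi>_nonneg by (intro mult_right_mono)
    finally have "(1 + a\<^sup>2 * (1 - a)) * \<Phi> (x', u') \<le> (1 + a\<^sup>2 * (1 - a)) * ((1 - b) * \<Phi> z)"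
      by (simp only: mult_ac)
    then show ?thesis
      using pos z' by simp
  qed
  have "\<Phi> (st k) \<le> \<Phi> (x0, x0) * (1 - b) ^ k" for k
  proof (induction k)
    case (Suc k)
    have "\<Phi> (st (Suc k)) \<le> (1 - b) * \<Phi> (st k)"
      using step[of "st k"] by (simp add: st_def)
    also have "\<dots> \<le> (1 - b) * (\<Phi> (x0, x0) * (1 - b) ^ k)"
      using Suc b1 by (intro mult_left_mono)
    finally show ?case
      by (simp add: mult_ac)
  qed (simp add: st_def)
  note decay = this[of N]
  \<comment> \<open>Initially \<open>u = x = x0\<close>: smoothness at \<open>xstar\<close> bounds
    the function gap by \<open>L / 2 * R\<^sup>2\<close>, and the distance term is at most as much
    again.\<close>
  have "f x0 - f xstar - inner (gf xstar) (x0 - xstar) \<le> L / 2 * (norm (x0 - xstar))\<^sup>2"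
    using assms(5) unfolding smooth_strongly_convex_def by blast
  moreover have "M / 2 * R\<^sup>2 \<le> L / 2 * R\<^sup>2"
    using assms(1,2) by (intro mult_right_mono) (auto simp: M_def)
  ultimately have "\<Phi> (x0, x0) \<le> L * R\<^sup>2"
    using grad assms(11) by (simp add: \<Phi>_def)
  then have "\<Phi> (x0, x0) * (1 - b) ^ N \<le> L * R\<^sup>2 * (1 - b) ^ N"
    using b1 by (intro mult_right_mono) auto
  moreover have "f (fst (st N)) - f xstar \<le> \<Phi> (st N)"
    using M by (simp add: \<Phi>_def)
  ultimately show ?thesis
    using decay by (simp add: reagm_x_def st_def M_def b_def)
qed

end
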